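(* Let $\psi$ be admissible. For every sequence $a=\{a_Q\}_{Q\in\mathcal Q}$ in $D(T_\psi)$, the value $T_\psi a$ is obtained by summing the terms as an infinite series in $\mathcal Z'$ in any order; that is, for every numbering $Q_1,Q_2,\dots$ of $\mathcal Q$, $$T_\psi a=\sum_{j=1}^\infty a_{Q_j}\psi_{Q_j}\qquad\text{with convergence in }\mathcal Z'.$$
   Context: Fourier transform: $\hat f(\xi)=\int e^{-i x\cdot\xi}f(x)\,dx$ on $\mathbb{R}^n$. Pairings are anti-linear in the second slot: $\langle f,\phi\rangle=\int f\overline{\phi}\,dx$ for functions. $\mathcal S$, $\mathcal S'$ are the Schwartz functions and tempered distributions on $\mathbb{R}^n$. Admissibility: fix constants $0<K_0<K_1<1<K^1<K^0$ with $2K_1<K^1$ and $K^0<\pi$. A function $\psi\in\mathcal S$ is admissible if $\operatorname{supp}\hat\psi\subset\{\xi: K_0\le|\xi|\le K^0\}$ and, for some $c>0$, $|\hat\psi(\xi)|\ge c$ for $K_1\le|\xi|\le K^1$. Dyadic cubes: for $\nu\in\mathbb{Z}$, $k\in\mathbb{Z}^n$, $Q_{\nu k}=\{x\in\mathbb{R}^n: k_i\le 2^\nu x_i<k_i+1,\ i=1,\dots,n\}$; $\mathcal Q$ is the set of all of these. For $Q=Q_{\nu k}$ set $\psi_Q(x)=2^{n\nu/2}\psi(2^\nu x-k)$. $\mathcal P$ is the space of polynomials; $\mathcal Z=\{\phi\in\mathcal S:\int x^\alpha\phi(x)\,dx=0\ \text{for all multiindices }\alpha\}$ with topology from $\mathcal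 S$; $\mathcal Z'=\mathcal S'/\mathcal P$ is its dual with the w$^*$-topology. Each $\psi_Q$ is identified with its class in $\mathcal Z'$. $D(T_\psi)$ is the set of complex families $a=\{a_Q\}_{Q\in\mathcal Q}$ with $\sum_{Q}|a_Q||\langle\psi_Q,\phi\rangle|<\infty$ for every $\phi\in\mathcal Z$; for $a\in D(T_\psi)$, $T_\psi a$ is the (well-defined) element of $\mathcal Z'$ with $\langle T_\psi a,\phi\rangle=\int_{\mathcal Q}a_Q\langle\psi_Q,\phi\rangle\,d\tau_{1+n}$ for all $\phi\in\mathcal Z$, where $\tau_{1+n}$ is the counting measure on $\mathcal Q$. *)

theory Defs
  imports "HOL-Analysis.Analysis"
begin

definition fourier :: "(real^'n \<Rightarrow> complex) \<Rightarrow> real^'n \<Rightarrow> complex" where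
  "fourier f \<xi> = (\<integral>x. exp (- \<i> * complex_of_real (x \<bullet> \<xi>)) * f x \<partial>lborel)"

text \<open>The pairing of functions, anti-linear in the second slot.\<close>

definition pairing :: "(real^'n \<Rightarrow> complex) \<Rightarrow> (real^'n \<Rightarrow> complex) \<Rightarrow> complex" where
  "pairing f \<phi> = (\<integral>x. f x * cnj (\<phi> x) \<partial>lborel)"

definition monomial :: "('n \<Rightarrow> nat) \<Rightarrow> real^'n \<Rightarrow> real" where
  "monomial \<alpha> x = (\<Prod>i\<in>UNIV. (x $ i) ^ \<alpha> i)"

definition partial_deriv :: "'n \<Rightarrow> (real^'n \<Rightarrow> complex) \<Rightarrow> real^'n \<Rightarrow> complex" where
  "partial_deriv i f x = frechet_derivative f (at x) (axis i 1)"

text \<open>Iterated partial derivatives are indexed by lists of directions rather than by multiindices;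
  for smooth functions the order of the directions is immaterial, so the same derivatives occur.\<close>

primrec iter_partial :: "'n list \<Rightarrow> (real^'n \<Rightarrow> complex) \<Rightarrow> real^'n \<Rightarrow> complex" where
  "iter_partial [] f = f"
| "iter_partial (i # is) f = partial_deriv i (iter_partial is f)"

definition smooth :: "(real^'n \<Rightarrow> complex) \<Rightarrow> bool" where
  "smooth f \<longleftrightarrow> (\<forall>is x. iter_partial is f differentiable (at x))"

definition schwartz :: "(real^'n \<Rightarrow> complex) set" where
  "schwartz = {f. smooth f \<and>
     (\<forall>\<alpha> is. bounded (range (\<lambda>x. complex_of_real (monomial \<alpha> x) * iter_partial is f x)))}"

definition schwartz_seminorm :: "('n \<Rightarrow> nat) \<Rightarrow> 'n list \<Rightarrow> (real^'n \<Rightarrow> complex) \<Rightarrow> real" where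
  "schwartz_seminorm \<alpha> is f =
     (SUP x. norm (complex_of_real (monomial \<alpha> x) * iter_partial is f x))"

definition schwartz_topology :: "(real^'n \<Rightarrow> complex) topology" where
  "schwartz_topology = topology_generated_by
     {{g \<in> schwartz. schwartz_seminorm \<alpha> is (\<lambda>x. g x - f x) < r} | f \<alpha> is r.
        f \<in> schwartz \<and> r > 0}"

definition Z_space :: "(real^'n \<Rightarrow> complex) set" where
  "Z_space = {\<phi> \<in> schwartz. \<forall>\<alpha>. (\<integral>x. complex_of_real (monomial \<alpha> x) * \<phi> x \<partial>lborel) = 0}"

text \<open>The dual of \<^term>\<open>Z_space\<close> consists of anti-linear functionals, in accordance with the
  convention for \<^const>\<open>pairing\<close>. A functional is a function on \<^term>\<open>Z_space\<close> only, encoded as an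
  extensional function, i.e. with the value \<^term>\<open>undefined\<close> elsewhere.\<close>

definition Z_dual :: "((real^'n \<Rightarrow> complex) \<Rightarrow> complex) set" where
  "Z_dual = {u \<in> extensional Z_space.
     (\<forall>\<phi>\<in>Z_space. \<forall>\<eta>\<in>Z_space. u (\<lambda>x. \<phi> x + \<eta> x) = u \<phi> + u \<eta>) \<and>
     (\<forall>c. \<forall>\<phi>\<in>Z_space. u (\<lambda>x. c * \<phi> x) = cnj c * u \<phi>) \<and>
     continuous_map (subtopology schwartz_topology Z_space) euclidean u}"

text \<open>The weak-star topology: pointwise convergence on \<^term>\<open>Z_space\<close>.\<close>

definition Z_dual_topology :: "((real^'n \<Rightarrow> complex) \<Rightarrow> complex) topology" where
  "Z_dual_topology = subtopology (product_topology (\<lambda>_. euclidean) Z_space) Z_dual"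

text \<open>The class, modulo polynomials, of a function regarded as a tempered distribution.\<close>

definition Z_class :: "(real^'n \<Rightarrow> complex) \<Rightarrow> (real^'n \<Rightarrow> complex) \<Rightarrow> complex" where
  "Z_class f = (\<lambda>\<phi>\<in>Z_space. pairing f \<phi>)"

text \<open>The outer constants, usually written with superscripts, are called \<open>L\<^sub>1\<close> and \<open>L\<^sub>0\<close>.
  The support is the closure of the non-vanishing set.\<close>

definition admissible ::
  "real \<Rightarrow> real \<Rightarrow> real \<Rightarrow> real \<Rightarrow> (real^'n \<Rightarrow> complex) \<Rightarrow> bool" where
  "admissible K\<^sub>0 K\<^sub>1 L\<^sub>1 L\<^sub>0 \<psi> \<longleftrightarrow>
     \<psi> \<in> schwartz \<and>
     closure {\<xi>. fourier \<psi> \<xi> \<noteq> 0} \<subseteq> {\<xi>. K\<^sub>0 \<le> norm \<xi> \<and> norm \<xi> \<le> L\<^sub>0} \<and>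
     (\<exists>c>0. \<forall>\<xi>. K\<^sub>1 \<le> norm \<xi> \<and> norm \<xi> \<le> L\<^sub>1 \<longrightarrow> c \<le> norm (fourier \<psi> \<xi>))"

definition dyadic_cube :: "int \<Rightarrow> int^'n \<Rightarrow> (real^'n) set" where
  "dyadic_cube \<nu> k =
     {x. \<forall>i. of_int (k $ i) \<le> 2 powi \<nu> * x $ i \<and> 2 powi \<nu> * x $ i < of_int (k $ i) + 1}"

definition dyadic_cubes :: "(real^'n) set set" where
  "dyadic_cubes = {dyadic_cube \<nu> k | \<nu> k. True}"

definition scaled_translate ::
  "(real^'n \<Rightarrow> complex) \<Rightarrow> int \<Rightarrow> int^'n \<Rightarrow> real^'n \<Rightarrow> complex" where
  "scaled_translate \<psi> \<nu> k x =
     complex_of_real (2 powr (real CARD('n) * real_of_int \<nu> / 2)) *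
     \<psi> (2 powi \<nu> *\<^sub>R x - (\<chi> i. of_int (k $ i)))"

text \<open>A cube determines its indices (\<open>dyadic_cube_eq_iff\<close> below), so \<^term>\<open>wavelet \<psi> Q\<close> is
  well defined; see \<open>wavelet_dyadic_cube\<close>.\<close>

definition wavelet :: "(real^'n \<Rightarrow> complex) \<Rightarrow> (real^'n) set \<Rightarrow> real^'n \<Rightarrow> complex" where
  "wavelet \<psi> Q = (THE g. \<exists>\<nu> k. Q = dyadic_cube \<nu> k \<and> g = scaled_translate \<psi> \<nu> k)"

lemma dyadic_cube_eq_iff:
  "dyadic_cube \<nu> k = dyadic_cube \<mu> l \<longleftrightarrow> \<nu> = \<mu> \<and> k = (l :: int^'n)"
proof
  have corner: "real_of_int (l $ i) * 2 powi \<nu> \<le> of_int (k $ i) * 2 powi \<mu>"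
    if "dyadic_cube \<nu> k = dyadic_cube \<mu> l" for \<nu> \<mu> i and k l :: "int^'n"
  proof -
    have "(\<chi> i. of_int (k $ i) / 2 powi \<nu>) \<in> dyadic_cube \<nu> k"
      by (simp add: dyadic_cube_def)
    then have "real_of_int (l $ i) \<le> 2 powi \<mu> * (of_int (k $ i) / 2 powi \<nu>)"
      unfolding that by (simp add: dyadic_cube_def)
    then show ?thesis
      by (simp add: field_simps)
  qed
  have scale: "\<mu> \<le> \<nu>" if eq: "dyadic_cube \<nu> k = dyadic_cube \<mu> l" for \<nu> \<mu> and k l :: "int^'n"
  proof (rule ccontr)
    assume "\<not> \<mu> \<le> \<nu>"
    then have less: "(2::real) powi \<nu> < 2 powi \<mu>"
      by (simp add: power_int_strict_increasing)
    define x :: "real^'n" where "x = (\<chi> i. of_int (k $ i) / 2 powi \<nu> + 1 / 2 powi \<mu>)"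
    have "x \<in> dyadic_cube \<nu> k"
      using less by (auto simp: dyadic_cube_def x_def distrib_left)
    then have "x \<in> dyadic_cube \<mu> l"
      using eq by simp
    then have "2 powi \<mu> * (of_int (k $ i) / 2 powi \<nu>) < real_of_int (l $ i)" for i
      by (simp add: dyadic_cube_def x_def distrib_left)
    then show False
      using corner[OF eq, of undefined] by (simp add: field_simps) (meson not_le)
  qed
  assume eq: "dyadic_cube \<nu> k = dyadic_cube \<mu> l"
  then have "\<nu> = \<mu>"
    using scale[OF eq] scale[OF eq[symmetric]] by simp
  moreover have "k $ i = l $ i" for i
    using corner[OF eq, of i] corner[OF eq[symmetric], of i] \<open>\<nu> = \<mu>\<close> by simp
  ultimately show "\<nu> = \<mu> \<and> k = l"
    by (simp add: vec_eq_iff)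
qed simp

lemma wavelet_dyadic_cube: "wavelet \<psi> (dyadic_cube \<nu> k) = scaled_translate \<psi> \<nu> k"
  unfolding wavelet_def by (rule the_equality) (auto simp: dyadic_cube_eq_iff)

definition D_synthesis :: "(real^'n \<Rightarrow> complex) \<Rightarrow> ((real^'n) set \<Rightarrow> complex) set" where
  "D_synthesis \<psi> = {a. \<forall>\<phi>\<in>Z_space.
     (\<lambda>Q. norm (a Q) * norm (pairing (wavelet \<psi> Q) \<phi>)) summable_on dyadic_cubes}"

text \<open>That \<open>synthesis \<psi> a\<close> is continuous, hence a member of \<^term>\<open>Z_dual\<close>, is not built into the
  definition; convergence to it in \<^term>\<open>Z_dual_topology\<close> includes that membership.\<close>

definition synthesis ::
  "(real^'n \<Rightarrow> complex) \<Rightarrow> ((real^'n) set \<Rightarrow> complex) \<Rightarrow> (real^'n \<Rightarrow> complex) \<Rightarrow> complex" where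
  "synthesis \<psi> a = (\<lambda>\<phi>\<in>Z_space.
     \<integral>Q. a Q * pairing (wavelet \<psi> Q) \<phi> \<partial>count_space dyadic_cubes)"

end

theory Submission
  imports Defs "HOL-Probability.Sinc_Integral"
begin

text \<open>Every \<open>\<psi>\<^sub>Q\<close> is bounded and continuous, and \<open>\<integral>\<bar>\<phi>\<bar>\<close> is dominated by Schwartz seminorms of
  \<open>\<phi>\<close>, so each term of the series is a continuous functional on \<^term>\<open>Z_space\<close>. For \<open>a\<close> in
  \<^term>\<open>D_synthesis \<psi>\<close> the series converges absolutely at every \<open>\<phi>\<close>, hence to the integral over
  the counting measure in any order. What remains is the continuity of the limit; it follows from
  the principle of uniform boundedness, because \<^term>\<open>Z_space\<close> is complete for a countable family
  of seminorms.\<close>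

section \<open>The Schwartz seminorms\<close>

text \<open>Weak-star convergence is only pointwise, and a pointwise limit of continuous functionals
  need not be continuous, while the limit has to lie in \<open>Z_dual\<close>. Since the topology
  comes from an increasing sequence of seminorms and not from one norm, uniform boundedness is
  proved without Baire category, along a single sequence whose k-th step is at most
  \<open>(1/2) ^ k\<close> in the k-th seminorm; only such rapidly convergent sequences need a
  limit. The principle is applied not to the partial sums of the series but to the sums of the
  absolute values of their terms. These increase with the number of terms, so a bound on the latest
  chosen sum bounds all earlier ones, and their boundedness at each \<phi> is what
  \<open>D_synthesis\<close> provides. The estimate obtained is uniform in the number of terms and
  therefore survives the passage to the limit.\<close>

lemma has_derivative_partial:
  fixes f :: "real^'n \<Rightarrow> complex"
  assumes "f differentiable (at x)"
  shows "(f has_derivative (\<lambda>h. \<Sum>i\<in>UNIV. h $ i *\<^sub>R partial_deriv i f x)) (at x)"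
proof -
  let ?D = "frechet_derivative f (at x)"
  have D: "(f has_derivative ?D) (at x)"
    using assms by (simp add: frechet_derivative_works)
  then interpret linear ?D
    by (rule has_derivative_linear)
  have "?D = (\<lambda>h. \<Sum>i\<in>UNIV. h $ i *\<^sub>R partial_deriv i f x)"
  proof
    fix h
    have "?D h = ?D (\<Sum>i\<in>UNIV. h $ i *\<^sub>R axis i 1)"
      using basis_expansion[of h] by (simp add: scalar_mult_eq_scaleR)
    also have "\<dots> = (\<Sum>i\<in>UNIV. h $ i *\<^sub>R partial_deriv i f x)"
      by (simp add: sum scaleR partial_deriv_def)
    finally show "?D h = (\<Sum>i\<in>UNIV. h $ i *\<^sub>R partial_deriv i f x)" .
  qed
  with D show ?thesis
    by simp
qed

text \<open>\<open>partial_deriv\<close> reads off the full derivative, so a full derivative has to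
  be supplied even to compute a single direction.\<close>

lemma partial_deriv_eqI:
  assumes "(f has_derivative (\<lambda>h. \<Sum>i\<in>UNIV. h $ i *\<^sub>R d i)) (at x)"
  shows "partial_deriv i f x = d i"
proof -
  have "frechet_derivative f (at x) = (\<lambda>h. \<Sum>i\<in>UNIV. h $ i *\<^sub>R d i)"
    using frechet_derivative_at[OF assms] by simp
  then show ?thesis
    by (simp add: partial_deriv_def axis_def if_distrib[of "\<lambda>c. c *\<^sub>R _"] sum.delta' cong: if_cong)
qed

lemma smooth_differentiable: "smooth f \<Longrightarrow> iter_partial is f differentiable (at x)"
  by (simp add: smooth_def)

text \<open>Two coefficients let one induction serve sums, differences and multiples: later uses
  take 1, -1 or 0.\<close>

lemma iter_partial_lincomb:
  fixes f g :: "real^'n \<Rightarrow> complex"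
  assumes "smooth f" "smooth g"
  shows "iter_partial is (\<lambda>x. c * f x + d * g x) =
    (\<lambda>x. c * iter_partial is f x + d * iter_partial is g x)"
proof (induction "is")
  case (Cons i "is")
  have "partial_deriv i (\<lambda>x. c * iter_partial is f x + d * iter_partial is g x) x =
      c * partial_deriv i (iter_partial is f) x + d * partial_deriv i (iter_partial is g) x" for x
  proof (rule partial_deriv_eqI)
    show "((\<lambda>x. c * iter_partial is f x + d * iter_partial is g x) has_derivative
        (\<lambda>h. \<Sum>i\<in>UNIV. h $ i *\<^sub>R (c * partial_deriv i (iter_partial is f) x +
          d * partial_deriv i (iter_partial is g) x))) (at x)"
      by (rule has_derivative_eq_rhs, rule has_derivative_add)
        (rule has_derivative_mult_right has_derivative_partial smooth_differentiable assms
          | simp add: scaleR_add_right sum.distrib sum_distrib_left)+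
  qed
  with Cons show ?case
    by auto
qed simp

lemma smooth_lincomb:
  assumes "smooth f" "smooth g"
  shows "smooth (\<lambda>x. c * f x + d * g x)"
  unfolding smooth_def iter_partial_lincomb[OF assms]
  by (intro allI differentiable_add differentiable_mult differentiable_const
      smooth_differentiable assms)

lemma smooth_continuous: "smooth f \<Longrightarrow> continuous_on UNIV (f :: real^'n \<Rightarrow> complex)"
  using smooth_differentiable[of f "[]"]
  by (simp add: continuous_at_imp_continuous_on differentiable_imp_continuous_within)

lemma schwartz_smooth: "f \<in> schwartz \<Longrightarrow> smooth f"
  by (simp add: schwartz_def)

lemma schwartz_lincomb:
  fixes f g :: "real^'n \<Rightarrow> complex"
  assumes "f \<in> schwartz" "g \<in> schwartz"
  shows "(\<lambda>x. c * f x + d * g x) \<in> schwartz"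
proof -
  have "bounded (range (\<lambda>x. complex_of_real (monomial \<alpha> x) *
      iter_partial is (\<lambda>x. c * f x + d * g x) x))" for \<alpha> "is"
  proof -
    have "bounded (range (\<lambda>x. e * (complex_of_real (monomial \<alpha> x) * iter_partial is h x)))"
      if "h \<in> schwartz" for e and h :: "real^'n \<Rightarrow> complex"
    proof -
      have "bounded (range (\<lambda>x. complex_of_real (monomial \<alpha> x) * iter_partial is h x))"
        using that by (simp add: schwartz_def)
      then show ?thesis
        using bounded_linear_image[OF _ bounded_linear_mult_right[of e]] by (fastforce simp: image_image)
    qed
    from bounded_plus_comp[OF this[OF assms(1), of c] this[OF assms(2), of d]]
    have "bounded (range (\<lambda>x. c * (complex_of_real (monomial \<alpha> x) * iter_partial is f x) +
        d * (complex_of_real (monomial \<alpha> x) * iter_partial is g x)))" .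
    then show ?thesis
      by (simp add: iter_partial_lincomb assms schwartz_smooth algebra_simps)
  qed
  with assms show ?thesis
    by (simp add: schwartz_def smooth_lincomb)
qed

lemma schwartz_seminorm_upper:
  assumes "f \<in> schwartz"
  shows "norm (complex_of_real (monomial \<alpha> x) * iter_partial is f x) \<le> schwartz_seminorm \<alpha> is f"
  unfolding schwartz_seminorm_def
proof (rule cSUP_upper)
  show "bdd_above (range (\<lambda>x. norm (complex_of_real (monomial \<alpha> x) * iter_partial is f x)))"
    using assms unfolding schwartz_def bounded_iff bdd_above_def by blast
qed simp

lemma schwartz_seminorm_least:
  assumes "\<And>x. norm (complex_of_real (monomial \<alpha> x) * iter_partial is f x) \<le> B"
  shows "schwartz_seminorm \<alpha> is f \<le> B"
  unfolding schwartz_seminorm_def by (rule cSUP_least) (use assms in auto)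

lemma schwartz_seminorm_nonneg: "f \<in> schwartz \<Longrightarrow> 0 \<le> schwartz_seminorm \<alpha> is f"
  using order_trans[OF norm_ge_zero schwartz_seminorm_upper] .

lemma schwartz_seminorm_mult_le:
  assumes "f \<in> schwartz"
  shows "schwartz_seminorm \<alpha> is (\<lambda>x. c * f x) \<le> norm c * schwartz_seminorm \<alpha> is f"
proof (rule schwartz_seminorm_least)
  fix x
  have "iter_partial is (\<lambda>x. c * f x) x = c * iter_partial is f x"
    using iter_partial_lincomb[of f f "is" c 0] assms by (simp add: schwartz_smooth)
  then show "norm (complex_of_real (monomial \<alpha> x) * iter_partial is (\<lambda>x. c * f x) x)
      \<le> norm c * schwartz_seminorm \<alpha> is f"
    using mult_left_mono[OF schwartz_seminorm_upper[OF assms, of \<alpha> x "is"], of "norm c"]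
    by (simp add: norm_mult mult_ac)
qed

text \<open>An increasing sequence of seminorms, which generates the Schwartz topology since
  pairs of a multiindex and a list of directions are countable.\<close>

definition schwartz_norm :: "nat \<Rightarrow> (real^'n \<Rightarrow> complex) \<Rightarrow> real" where
  "schwartz_norm N f = (\<Sum>k\<le>N. case from_nat k of (\<alpha>, is) \<Rightarrow> schwartz_seminorm \<alpha> is f)"

lemma schwartz_norm_nonneg: "f \<in> schwartz \<Longrightarrow> 0 \<le> schwartz_norm N f"
  unfolding schwartz_norm_def
  by (intro sum_nonneg) (simp add: schwartz_seminorm_nonneg split: prod.split)

lemma schwartz_norm_mono:
  "f \<in> schwartz \<Longrightarrow> M \<le> N \<Longrightarrow> schwartz_norm M f \<le> schwartz_norm N f"
  unfolding schwartz_norm_def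
  by (intro sum_mono2) (auto simp: schwartz_seminorm_nonneg split: prod.split)

lemma schwartz_norm_mult_le:
  assumes "f \<in> schwartz"
  shows "schwartz_norm N (\<lambda>x. c * f x) \<le> norm c * schwartz_norm N f"
  unfolding schwartz_norm_def sum_distrib_left
  by (intro sum_mono) (simp add: schwartz_seminorm_mult_le assms split: prod.split)

text \<open>The code of the pair is the index at which its seminorm enters the sum; every later
  threshold of the form \<open>to_nat (\<alpha>, is) \<le> k\<close> comes from here.\<close>

lemma schwartz_seminorm_le_norm:
  assumes "f \<in> schwartz" "to_nat (\<alpha>, is) \<le> N"
  shows "schwartz_seminorm \<alpha> is f \<le> schwartz_norm N f"
proof -
  have "(case from_nat (to_nat (\<alpha>, is)) of (\<alpha>, is) \<Rightarrow> schwartz_seminorm \<alpha> is f)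
      \<le> schwartz_norm N f"
    unfolding schwartz_norm_def using assms
    by (intro member_le_sum) (auto simp: schwartz_seminorm_nonneg split: prod.split)
  then show ?thesis
    by simp
qed

section \<open>Integrability of Schwartz functions\<close>

lemma integrable_inverse_one_plus_square: "integrable lborel (\<lambda>x::real. inverse (1 + x\<^sup>2))"
  using integrable_inverse_1_plus_square by (simp add: set_integrable_def)

text \<open>The product form reduces integrability to one variable by Tonelli, and its reciprocal
  expands into monomials.\<close>

definition cauchy_weight :: "real^'n \<Rightarrow> real" where
  "cauchy_weight x = (\<Prod>i\<in>UNIV. inverse (1 + (x $ i)\<^sup>2))"

lemma cauchy_weight_nonneg: "0 \<le> cauchy_weight x"
  unfolding cauchy_weight_def by (intro prod_nonneg) simp

lemma prod_Basis_vec: "(\<Prod>b\<in>Basis. f (x \<bullet> b)) = (\<Prod>i\<in>UNIV. f ((x :: real^'n) $ i))"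
proof -
  have "bij_betw (\<lambda>i. axis i 1) UNIV (Basis :: (real^'n) set)"
    by (auto simp: bij_betw_def inj_on_def axis_eq_axis Basis_vec_def)
  from prod.reindex_bij_betw[OF this, of "\<lambda>b. f (x \<bullet> b)"] show ?thesis
    by (simp add: inner_axis)
qed

lemma integrable_cauchy_weight: "integrable lborel (cauchy_weight :: real^'n \<Rightarrow> real)"
proof (rule integrableI_nonneg)
  show "(cauchy_weight :: real^'n \<Rightarrow> real) \<in> borel_measurable lborel"
    unfolding cauchy_weight_def by measurable
  have "(\<integral>\<^sup>+x. ennreal (cauchy_weight x) \<partial>(lborel :: (real^'n) measure)) =
      (\<integral>\<^sup>+x. (\<Prod>b\<in>Basis. ennreal (inverse (1 + (x \<bullet> b)\<^sup>2))) \<partial>(lborel :: (real^'n) measure))"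
    unfolding cauchy_weight_def
    by (intro nn_integral_cong) (simp add: prod_ennreal prod_Basis_vec[of "\<lambda>t. ennreal (inverse (1 + t\<^sup>2))"])
  also have "\<dots> = (\<Prod>b\<in>(Basis :: (real^'n) set). \<integral>\<^sup>+x. ennreal (inverse (1 + x\<^sup>2)) \<partial>lborel)"
    by (rule nn_integral_lborel_prod) auto
  also have "\<dots> < \<infinity>"
    using integrable_inverse_one_plus_square
    by (simp add: integrable_iff_bounded power_less_top_ennreal)
  finally show "(\<integral>\<^sup>+x. ennreal (cauchy_weight x) \<partial>(lborel :: (real^'n) measure)) < \<infinity>" .
qed (simp add: cauchy_weight_nonneg)

section \<open>Decay of Schwartz functions and integrals against bounded functions\<close>

lemma monomial_mult: "monomial (\<lambda>i. \<alpha> i + \<beta> i) x = monomial \<alpha> x * monomial \<beta> x"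
  by (simp add: monomial_def power_add prod.distrib)

text \<open>Expanding the product of the factors \<open>(x $ i)\<^sup>2 + 1\<close> gives one
  squared monomial for each set T of coordinates, so dividing by the weight stays within the
  available seminorms.\<close>

lemma cauchy_weight_mult_monomials:
  "cauchy_weight (x :: real^'n) *
    (\<Sum>T\<in>UNIV. monomial (\<lambda>i. if i \<in> T then 2 else 0) x) = 1"
proof -
  have "monomial (\<lambda>i. if i \<in> T then 2 else 0) x = (\<Prod>i\<in>T. (x $ i)\<^sup>2)" for T
    unfolding monomial_def by (subst prod.mono_neutral_cong_right[of UNIV T]) auto
  then have "(\<Sum>T\<in>UNIV. monomial (\<lambda>i. if i \<in> T then 2 else 0) x) = (\<Prod>i\<in>UNIV. (x $ i)\<^sup>2 + 1)"
    by (subst prod_add) simp_all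
  moreover have "(x $ i)\<^sup>2 + 1 \<noteq> 0" for i
    by (metis add_nonneg_pos less_irrefl zero_le_power2 zero_less_one)
  ultimately show ?thesis
    by (simp add: cauchy_weight_def add.commute flip: prod.distrib)
qed

definition decay_norm :: "('n \<Rightarrow> nat) \<Rightarrow> (real^'n \<Rightarrow> complex) \<Rightarrow> real" where
  "decay_norm \<alpha> f =
    (\<Sum>T\<in>UNIV. schwartz_seminorm (\<lambda>i. \<alpha> i + (if i \<in> T then 2 else 0)) [] f)"

lemma norm_monomial_mult_le:
  fixes f :: "real^'n \<Rightarrow> complex"
  assumes "f \<in> schwartz"
  shows "norm (complex_of_real (monomial \<alpha> x) * f x) \<le> decay_norm \<alpha> f * cauchy_weight x"
proof -
  let ?m = "\<lambda>T. monomial (\<lambda>i. if i \<in> T then 2 else 0) x"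
  \<comment> \<open>Nonnegative because all exponents are even; this lets the monomials move inside
    the norm.\<close>
  have m: "0 \<le> ?m T" for T
    unfolding monomial_def by (intro prod_nonneg) auto
  have "norm (complex_of_real (monomial \<alpha> x) * f x) =
      cauchy_weight x * (\<Sum>T\<in>UNIV. ?m T) * norm (complex_of_real (monomial \<alpha> x) * f x)"
    by (simp only: cauchy_weight_mult_monomials mult_1)
  also have "\<dots> = cauchy_weight x *
      (\<Sum>T\<in>UNIV. norm (complex_of_real (monomial (\<lambda>i. \<alpha> i + (if i \<in> T then 2 else 0)) x) * f x))"
    using m by (simp add: monomial_mult norm_mult abs_mult sum_distrib_left mult_ac)
  also have "\<dots> \<le> cauchy_weight x * decay_norm \<alpha> f"
    unfolding decay_norm_def using schwartz_seminorm_upper[OF assms, of _ x "[]"]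
    by (intro mult_left_mono sum_mono cauchy_weight_nonneg) simp
  finally show ?thesis
    by (simp add: mult.commute)
qed

lemma borel_measurable_schwartz: "f \<in> schwartz \<Longrightarrow> f \<in> borel_measurable lborel"
  using borel_measurable_continuous_onI[OF smooth_continuous[OF schwartz_smooth]] by simp

lemma borel_measurable_monomial: "monomial \<alpha> \<in> borel_measurable lborel"
  unfolding monomial_def[abs_def] by measurable

text \<open>Dominated by a multiple of \<open>cauchy_weight\<close>. The constant factor g = 1
  yields the moments, and a conjugated bounded function yields the pairings.\<close>

lemma
  fixes f g :: "real^'n \<Rightarrow> complex"
  assumes f: "f \<in> schwartz" and g: "g \<in> borel_measurable lborel" "\<And>x. norm (g x) \<le> B"
  shows integrable_bounded_mult_schwartz:
      "integrable lborel (\<lambda>x. g x * (complex_of_real (monomial \<alpha> x) * f x))"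
    and norm_integral_bounded_mult_schwartz_le:
      "norm (\<integral>x. g x * (complex_of_real (monomial \<alpha> x) * f x) \<partial>lborel)
        \<le> B * integral\<^sup>L lborel (cauchy_weight :: real^'n \<Rightarrow> real) * decay_norm \<alpha> f"
proof -
  note [measurable] = g(1) borel_measurable_schwartz[OF f] borel_measurable_monomial
  have B: "0 \<le> B"
    using g(2) norm_ge_zero order_trans by blast
  have le: "norm (g x * (complex_of_real (monomial \<alpha> x) * f x))
      \<le> B * decay_norm \<alpha> f * cauchy_weight x" for x
    unfolding norm_mult[of "g x"] mult.assoc
    by (intro mult_mono g(2) norm_monomial_mult_le f B) simp
  have int: "integrable lborel (\<lambda>x :: real^'n. B * decay_norm \<alpha> f * cauchy_weight x)"
    by (intro integrable_mult_right integrable_cauchy_weight)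
  show int': "integrable lborel (\<lambda>x. g x * (complex_of_real (monomial \<alpha> x) * f x))"
    by (rule Bochner_Integration.integrable_bound[OF int])
      (use le in \<open>auto intro!: always_eventually order_trans[OF _ abs_ge_self]\<close>)
  have "norm (\<integral>x. g x * (complex_of_real (monomial \<alpha> x) * f x) \<partial>lborel)
      \<le> (\<integral>x. B * decay_norm \<alpha> f * cauchy_weight x \<partial>(lborel :: (real^'n) measure))"
    by (rule order_trans[OF integral_norm_bound])
      (intro integral_mono integrable_norm int int' le)
  then show "norm (\<integral>x. g x * (complex_of_real (monomial \<alpha> x) * f x) \<partial>lborel)
      \<le> B * integral\<^sup>L lborel (cauchy_weight :: real^'n \<Rightarrow> real) * decay_norm \<alpha> f"
    by (simp add: mult_ac)
qed

lemma decay_norm_le_schwartz_norm: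
  "\<exists>C N. 0 \<le> C \<and> (\<forall>f\<in>schwartz. decay_norm \<alpha> (f :: real^'n \<Rightarrow> complex) \<le> C * schwartz_norm N f)"
proof (intro exI conjI ballI)
  let ?\<beta> = "\<lambda>T i. \<alpha> i + (if i \<in> T then 2 else 0)"
  \<comment> \<open>A sum of naturals bounds each summand, so this is a common index for the
    finitely many seminorms in \<open>decay_norm\<close>.\<close>
  let ?N = "\<Sum>T\<in>UNIV. to_nat (?\<beta> T, [] :: 'n list)"
  fix f :: "real^'n \<Rightarrow> complex" assume f: "f \<in> schwartz"
  have "to_nat (?\<beta> T, [] :: 'n list) \<le> ?N" for T
    by (intro member_le_sum) auto
  then have "decay_norm \<alpha> f \<le> (\<Sum>T\<in>(UNIV :: 'n set set). schwartz_norm ?N f)"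
    unfolding decay_norm_def by (intro sum_mono schwartz_seminorm_le_norm f)
  then show "decay_norm \<alpha> f \<le> real (card (UNIV :: 'n set set)) * schwartz_norm ?N f"
    by simp
qed simp

section \<open>The space of Schwartz functions with vanishing moments\<close>

lemma Z_space_schwartz: "\<phi> \<in> Z_space \<Longrightarrow> \<phi> \<in> schwartz"
  by (simp add: Z_space_def)

lemma integrable_monomial_mult_schwartz:
  "f \<in> schwartz \<Longrightarrow> integrable lborel (\<lambda>x. complex_of_real (monomial \<alpha> x) * f x)"
  using integrable_bounded_mult_schwartz[of f "\<lambda>_. 1" 1 \<alpha>] by simp

lemma Z_space_lincomb:
  fixes \<phi> \<eta> :: "real^'n \<Rightarrow> complex"
  assumes "\<phi> \<in> Z_space" "\<eta> \<in> Z_space"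
  shows "(\<lambda>x. c * \<phi> x + d * \<eta> x) \<in> Z_space"
proof -
  have "(\<integral>x. complex_of_real (monomial \<alpha> x) * (c * \<phi> x + d * \<eta> x) \<partial>lborel) = 0" for \<alpha>
  proof -
    have "(\<integral>x. complex_of_real (monomial \<alpha> x) * (c * \<phi> x + d * \<eta> x) \<partial>lborel) =
        (\<integral>x. c * (complex_of_real (monomial \<alpha> x) * \<phi> x) +
          d * (complex_of_real (monomial \<alpha> x) * \<eta> x) \<partial>lborel)"
      by (simp add: algebra_simps)
    also have "\<dots> = 0"
      using assms by (subst Bochner_Integration.integral_add)
        (auto intro: integrable_monomial_mult_schwartz simp: Z_space_def)
    finally show ?thesis .
  qed
  with assms show ?thesis
    by (simp add: Z_space_def schwartz_lincomb)
qed

lemma Z_space_add: "\<phi> \<in> Z_space \<Longrightarrow> \<eta> \<in> Z_space \<Longrightarrow> (\<lambda>x. \<phi> x + \<eta> x) \<in> Z_space"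
  using Z_space_lincomb[of \<phi> \<eta> 1 1] by simp

lemma Z_space_diff: "\<phi> \<in> Z_space \<Longrightarrow> \<eta> \<in> Z_space \<Longrightarrow> (\<lambda>x. \<phi> x - \<eta> x) \<in> Z_space"
  using Z_space_lincomb[of \<phi> \<eta> 1 "-1"] by simp

lemma Z_space_mult: "\<phi> \<in> Z_space \<Longrightarrow> (\<lambda>x. c * \<phi> x) \<in> Z_space"
  using Z_space_lincomb[of \<phi> \<phi> c 0] by simp

section \<open>Completeness of \<open>Z_space\<close>\<close>

lemma iter_partial_diff:
  "smooth f \<Longrightarrow> smooth g \<Longrightarrow>
    iter_partial is (\<lambda>x. f x - g x) = (\<lambda>x. iter_partial is f x - iter_partial is g x)"
  using iter_partial_lincomb[of f g "is" 1 "-1"] by simp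

text \<open>The subtracted term is the part of the geometric series not yet used; without it the
  induction on j would not close.\<close>

lemma Cauchy_geometric_bound:
  fixes s :: "nat \<Rightarrow> 'a::real_normed_vector"
  assumes "\<And>k. m \<le> k \<Longrightarrow> norm (s (Suc k) - s k) \<le> (1/2) ^ k" and "m \<le> k"
  shows "norm (s (k + j) - s k) \<le> 2 * (1/2) ^ k - 2 * (1/2) ^ (k + j)"
proof (induction j)
  case (Suc j)
  have "norm (s (k + Suc j) - s k) \<le> norm (s (Suc (k + j)) - s (k + j)) + norm (s (k + j) - s k)"
    using norm_triangle_ineq[of "s (Suc (k + j)) - s (k + j)" "s (k + j) - s k"] by simp
  with Suc assms(1)[of "k + j"] assms(2) show ?case
    by simp
qed simp

text \<open>Each fixed seminorm is part of \<open>schwartz_norm k\<close> for all large k, so it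
  sees a geometric series. All derivatives then converge uniformly, also after multiplication by
  monomials, and the moments pass to the limit by domination.\<close>

lemma Z_space_complete:
  fixes y :: "nat \<Rightarrow> real^'n \<Rightarrow> complex"
  assumes Z: "\<And>k. y k \<in> Z_space"
    and step: "\<And>k. schwartz_norm k (\<lambda>x. y (Suc k) x - y k x) \<le> (1/2) ^ k"
  obtains f where "f \<in> Z_space"
    and "\<And>N. (\<lambda>k. schwartz_norm N (\<lambda>x. f x - y k x)) \<longlonglongrightarrow> 0"
proof -
  let ?D = "\<lambda>is k x. iter_partial is (y k) x"
  let ?m = "\<lambda>\<alpha> is. to_nat (\<alpha> :: 'n \<Rightarrow> nat, is :: 'n list)"
  have S: "y k \<in> schwartz" for k
    using Z by (rule Z_space_schwartz)
  have diff: "iter_partial is (\<lambda>x. y k x - y l x) = (\<lambda>x. ?D is k x - ?D is l x)" for "is" k l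
    by (intro iter_partial_diff schwartz_smooth S)
  have bound: "norm (complex_of_real (monomial \<alpha> x) * ?D is (k + j) x -
      complex_of_real (monomial \<alpha> x) * ?D is k x) \<le> 2 * (1/2) ^ k"
    if "?m \<alpha> is \<le> k" for \<alpha> "is" k j x
  proof -
    have "norm (complex_of_real (monomial \<alpha> x) * ?D is (Suc k) x -
        complex_of_real (monomial \<alpha> x) * ?D is k x) \<le> (1/2) ^ k" if k: "?m \<alpha> is \<le> k" for k
    proof -
      have sch: "(\<lambda>x. y (Suc k) x - y k x) \<in> schwartz"
        by (intro Z_space_schwartz Z_space_diff Z)
      have "norm (complex_of_real (monomial \<alpha> x) * iter_partial is (\<lambda>x. y (Suc k) x - y k x) x)
          \<le> (1/2) ^ k"
        using schwartz_seminorm_upper[OF sch, of \<alpha> x "is"]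
          schwartz_seminorm_le_norm[OF sch k] step[of k] by linarith
      then show ?thesis
        by (simp add: diff right_diff_distrib)
    qed
    from Cauchy_geometric_bound[OF this that, of j] show ?thesis
      by (smt (verit) zero_le_power divide_nonneg_nonneg)
  qed
  \<comment> \<open>Limits of all derivatives are taken at once; \<open>g []\<close> is the
    candidate, and the other members of the family must turn out to be its derivatives.\<close>
  define g where "g is x = lim (\<lambda>k. ?D is k x)" for "is" x
  have lim: "(\<lambda>k. ?D is k x) \<longlonglongrightarrow> g is x" for "is" x
  proof -
    have "Cauchy (\<lambda>k. ?D is k x)"
    proof (rule CauchyI')
      fix e :: real assume "0 < e"
      then obtain K where "(1/2) ^ K < e / 2"
        using real_arch_pow_inv[of "e/2" "1/2"] by auto
      then have K: "2 * (1/2) ^ K < e"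
        by simp
      \<comment> \<open>The zero multiindex has monomial 1, so its bound concerns the derivative
        itself.\<close>
      let ?M = "max K (?m (\<lambda>_. 0) is)"
      have "norm (?D is m x - ?D is n x) < e" if "?M \<le> m" "m < n" for m n
      proof -
        have "norm (?D is n x - ?D is m x) \<le> 2 * (1/2) ^ m"
          using bound[of "\<lambda>_. 0" "is" m x "n - m"] that by (simp add: monomial_def)
        also have "\<dots> \<le> 2 * (1/2) ^ K"
          using that by (simp add: power_decreasing)
        finally show ?thesis
          using K by (simp add: norm_minus_commute)
      qed
      then show "\<exists>M. \<forall>m\<ge>M. \<forall>n>m. dist (?D is m x) (?D is n x) < e"
        unfolding dist_norm by blast
    qed
    then show ?thesis
      unfolding g_def by (simp add: Cauchy_convergent_iff convergent_LIMSEQ_iff)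
  qed
  have limit_bound: "norm (complex_of_real (monomial \<alpha> x) * (g is x - ?D is k x)) \<le> 2 * (1/2) ^ k"
    if "?m \<alpha> is \<le> k" for \<alpha> "is" k x
  proof (rule Lim_norm_ubound[OF sequentially_bot])
    show "(\<lambda>j. complex_of_real (monomial \<alpha> x) * (?D is (k + j) x - ?D is k x))
        \<longlonglongrightarrow> complex_of_real (monomial \<alpha> x) * (g is x - ?D is k x)"
      using LIMSEQ_ignore_initial_segment[OF lim[of "is" x], of k]
      by (intro tendsto_intros) (simp add: add.commute)
    show "eventually (\<lambda>j. norm (complex_of_real (monomial \<alpha> x) * (?D is (k + j) x - ?D is k x))
        \<le> 2 * (1/2) ^ k) sequentially"
      using bound[OF that] by (simp add: right_diff_distrib)
  qed
  have deriv: "(g is has_derivative (\<lambda>h. \<Sum>i\<in>UNIV. h $ i *\<^sub>R g (i # is) x)) (at x)" for "is" x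
  proof -
    \<comment> \<open>Termwise differentiation: the derivatives converge uniformly on a convex set
      and the functions converge at 0. The limit G is identified with \<open>g is\<close>
      afterwards.\<close>
    have "\<exists>G. \<forall>x\<in>UNIV. (\<lambda>k. ?D is k x) \<longlonglongrightarrow> G x \<and>
        (G has_derivative (\<lambda>h. \<Sum>i\<in>UNIV. h $ i *\<^sub>R g (i # is) x)) (at x within UNIV)"
    proof (rule has_derivative_sequence[OF convex_UNIV])
      show "(?D is k has_derivative (\<lambda>h. \<Sum>i\<in>UNIV. h $ i *\<^sub>R ?D (i # is) k x)) (at x within UNIV)"
        for k x
        using has_derivative_partial[OF smooth_differentiable[OF schwartz_smooth[OF S]]] by simp
      show "\<forall>\<^sub>F k in sequentially. \<forall>x\<in>UNIV. \<forall>h :: real^'n.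
          norm ((\<Sum>i\<in>UNIV. h $ i *\<^sub>R ?D (i # is) k x) - (\<Sum>i\<in>UNIV. h $ i *\<^sub>R g (i # is) x))
            \<le> e * norm h" if "0 < e" for e
      proof -
        let ?c = "real CARD('n)"
        \<comment> \<open>The 2 absorbs the factor in \<open>limit_bound\<close>, and
          \<open>?c\<close> the sum over all directions.\<close>
        obtain K where K: "(1/2) ^ K < e / (2 * ?c)"
          using real_arch_pow_inv[of "e / (2 * ?c)" "1/2"] \<open>0 < e\<close> by auto
        let ?M = "max K (\<Sum>i\<in>UNIV. ?m (\<lambda>_. 0) (i # is))"
        have "norm ((\<Sum>i\<in>UNIV. h $ i *\<^sub>R ?D (i # is) k x) - (\<Sum>i\<in>UNIV. h $ i *\<^sub>R g (i # is) x))
            \<le> e * norm h" if k: "?M \<le> k" for k x and h :: "real^'n"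
        proof -
          have "norm ((\<Sum>i\<in>UNIV. h $ i *\<^sub>R ?D (i # is) k x) - (\<Sum>i\<in>UNIV. h $ i *\<^sub>R g (i # is) x))
              \<le> (\<Sum>i\<in>UNIV. norm (h $ i *\<^sub>R (g (i # is) x - ?D (i # is) k x)))"
            unfolding sum_subtractf[symmetric] scaleR_diff_right[symmetric]
            by (rule order_trans[OF norm_sum]) (simp add: norm_minus_commute)
          also have "\<dots> \<le> (\<Sum>i\<in>(UNIV :: 'n set). norm h * (e / ?c))"
          proof (rule sum_mono)
            fix i :: 'n
            have "?m (\<lambda>_. 0) (i # is) \<le> (\<Sum>i\<in>UNIV. ?m (\<lambda>_. 0) (i # is))"
              by (rule member_le_sum) auto
            with k have "norm (g (i # is) x - ?D (i # is) k x) \<le> 2 * (1/2) ^ k"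
              using limit_bound[of "\<lambda>_. 0" "i # is" k x] by (simp add: monomial_def)
            also have "\<dots> \<le> 2 * (1/2) ^ K"
              using k by (simp add: power_decreasing)
            also have "\<dots> \<le> e / ?c"
              using K by simp
            finally show "norm (h $ i *\<^sub>R (g (i # is) x - ?D (i # is) k x)) \<le> norm h * (e / ?c)"
              unfolding norm_scaleR by (intro mult_mono component_le_norm_cart[of h i, unfolded real_norm_def]) auto
          qed
          finally show ?thesis
            by (simp add: mult.commute)
        qed
        then show ?thesis
          unfolding eventually_sequentially by blast
      qed
      show "(\<lambda>k. ?D is k 0) \<longlonglongrightarrow> g is 0"
        by (rule lim)
    qed simp
    then obtain G where G: "\<And>x. (\<lambda>k. ?D is k x) \<longlonglongrightarrow> G x"
        "\<And>x. (G has_derivative (\<lambda>h. \<Sum>i\<in>UNIV. h $ i *\<^sub>R g (i # is) x)) (at x)"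
      by auto
    have "G = g is"
      using LIMSEQ_unique[OF G(1) lim] by auto
    with G(2) show ?thesis
      by simp
  qed
  have iter: "iter_partial is (g []) = g is" for "is"
  proof (induction "is")
    case (Cons i "is")
    then show ?case
      using partial_deriv_eqI[OF deriv] by auto
  qed simp
  have smooth: "smooth (g [])"
    unfolding smooth_def iter using deriv by (auto simp: differentiable_def)
  have "bounded (range (\<lambda>x. complex_of_real (monomial \<alpha> x) * iter_partial is (g []) x))" for \<alpha> "is"
  proof -
    \<comment> \<open>The first index at which \<open>limit_bound\<close> applies; the single
      Schwartz function \<open>y ?k\<close> then bounds the limit.\<close>
    let ?k = "?m \<alpha> is"
    have "norm (complex_of_real (monomial \<alpha> x) * g is x) \<le>
        2 * (1/2) ^ ?k + schwartz_seminorm \<alpha> is (y ?k)" for x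
    proof -
      have "complex_of_real (monomial \<alpha> x) * g is x =
          complex_of_real (monomial \<alpha> x) * (g is x - ?D is ?k x) +
          complex_of_real (monomial \<alpha> x) * ?D is ?k x"
        by (simp add: algebra_simps)
      then show ?thesis
        using norm_triangle_le[OF add_mono[OF limit_bound[of \<alpha> "is" ?k x, OF order_refl]
            schwartz_seminorm_upper[OF S[of ?k], of \<alpha> x "is"]]]
        by simp
    qed
    then show ?thesis
      unfolding iter bounded_iff by blast
  qed
  with smooth have sch: "g [] \<in> schwartz"
    by (simp add: schwartz_def)
  have seminorm: "(\<lambda>k. schwartz_seminorm \<alpha> is (\<lambda>x. g [] x - y k x)) \<longlonglongrightarrow> 0" for \<alpha> "is"
  proof (rule tendsto_sandwich)
    have "(\<lambda>x. g [] x - y k x) \<in> schwartz" for k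
      using schwartz_lincomb[OF sch S[of k], of 1 "-1"] by simp
    then show "eventually (\<lambda>k. 0 \<le> schwartz_seminorm \<alpha> is (\<lambda>x. g [] x - y k x)) sequentially"
      by (simp add: schwartz_seminorm_nonneg)
    have "schwartz_seminorm \<alpha> is (\<lambda>x. g [] x - y k x) \<le> 2 * (1/2) ^ k" if "?m \<alpha> is \<le> k" for k
      by (rule schwartz_seminorm_least)
        (use limit_bound[OF that] in \<open>simp add: iter_partial_diff smooth schwartz_smooth[OF S] iter\<close>)
    then show "eventually (\<lambda>k. schwartz_seminorm \<alpha> is (\<lambda>x. g [] x - y k x) \<le> 2 * (1/2) ^ k)
        sequentially"
      unfolding eventually_sequentially by blast
    show "(\<lambda>k. 2 * (1/2) ^ k :: real) \<longlonglongrightarrow> 0"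
      by (rule tendsto_mult_right_zero) (simp add: LIMSEQ_power_zero)
  qed simp
  have "(\<integral>x. complex_of_real (monomial \<alpha> x) * g [] x \<partial>lborel) = 0" for \<alpha>
  proof -
    let ?I = "\<integral>x. complex_of_real (monomial \<alpha> x) * g [] x \<partial>lborel"
    let ?B = "integral\<^sup>L lborel (cauchy_weight :: real^'n \<Rightarrow> real)"
    \<comment> \<open>Subtracting \<open>y k\<close> leaves the moment unchanged because the moments
      of \<open>y k\<close> vanish, while the bound tends to 0.\<close>
    have "norm ?I \<le> ?B * decay_norm \<alpha> (\<lambda>x. g [] x - y k x)" for k
    proof -
      have sch': "(\<lambda>x. g [] x - y k x) \<in> schwartz"
        using schwartz_lincomb[OF sch S[of k], of 1 "-1"] by simp
      have "(\<integral>x. complex_of_real (monomial \<alpha> x) * (g [] x - y k x) \<partial>lborel) = ?I"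
        using Z[of k] integrable_monomial_mult_schwartz[OF sch, of \<alpha>]
          integrable_monomial_mult_schwartz[OF S, of \<alpha> k]
        by (simp add: right_diff_distrib Z_space_def)
      then show ?thesis
        using norm_integral_bounded_mult_schwartz_le[OF sch', of "\<lambda>_. 1" 1 \<alpha>] by simp
    qed
    moreover have "(\<lambda>k. ?B * decay_norm \<alpha> (\<lambda>x. g [] x - y k x)) \<longlonglongrightarrow> 0"
      unfolding decay_norm_def
      by (intro tendsto_mult_right_zero tendsto_null_sum seminorm)
    ultimately have "norm ?I \<le> 0"
      by (intro LIMSEQ_le_const) auto
    then show ?thesis
      by simp
  qed
  with sch have "g [] \<in> Z_space"
    by (simp add: Z_space_def)
  moreover have "(\<lambda>k. schwartz_norm N (\<lambda>x. g [] x - y k x)) \<longlonglongrightarrow> 0" for N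
    unfolding schwartz_norm_def
    by (intro tendsto_null_sum) (simp add: seminorm case_prod_unfold)
  ultimately show ?thesis
    by (rule that)
qed

section \<open>Uniform boundedness\<close>

text \<open>For a seminorm this is continuity at 0. A single index suffices because the seminorms
  \<open>schwartz_norm N\<close> increase with N.\<close>

definition Z_bounded :: "((real^'n \<Rightarrow> complex) \<Rightarrow> real) \<Rightarrow> bool" where
  "Z_bounded q \<longleftrightarrow> (\<exists>C N. \<forall>\<phi>\<in>Z_space. q \<phi> \<le> C * schwartz_norm N \<phi>)"

text \<open>A positive constant can be divided by, and a free index M lets several bounds share one
  seminorm.\<close>

lemma Z_boundedE:
  assumes "Z_bounded q"
  obtains C N where "0 < C" "\<And>\<phi> M. \<phi> \<in> Z_space \<Longrightarrow> N \<le> M \<Longrightarrow> q \<phi> \<le> C * schwartz_norm M \<phi>"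
proof -
  obtain C N where CN: "\<And>\<phi>. \<phi> \<in> Z_space \<Longrightarrow> q \<phi> \<le> C * schwartz_norm N \<phi>"
    using assms unfolding Z_bounded_def by blast
  have "q \<phi> \<le> (\<bar>C\<bar> + 1) * schwartz_norm M \<phi>" if "\<phi> \<in> Z_space" "N \<le> M" for \<phi> M
  proof -
    have "C * schwartz_norm N \<phi> \<le> (\<bar>C\<bar> + 1) * schwartz_norm M \<phi>"
      using that by (intro mult_mono schwartz_norm_mono schwartz_norm_nonneg Z_space_schwartz) auto
    with CN[OF that(1)] show ?thesis
      by linarith
  qed
  then show ?thesis
    using that[of "\<bar>C\<bar> + 1" N] by simp
qed

lemma Z_bounded_sum:
  fixes q :: "'i \<Rightarrow> (real^'n \<Rightarrow> complex) \<Rightarrow> real"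
  assumes "\<And>i. i \<in> I \<Longrightarrow> Z_bounded (q i)"
  shows "Z_bounded (\<lambda>\<phi>. \<Sum>i\<in>I. q i \<phi>)"
proof (cases "finite I")
  case True
  then show ?thesis
    using assms
  proof (induction I)
    case empty
    show ?case
      unfolding Z_bounded_def by (intro exI[of _ 0]) simp
  next
    case (insert i I)
    obtain C N where C: "0 < C" "\<And>\<phi> M. \<phi> \<in> Z_space \<Longrightarrow> N \<le> M \<Longrightarrow> q i \<phi> \<le> C * schwartz_norm M \<phi>"
      using Z_boundedE[of "q i"] insert.prems by auto
    obtain C' N' where C': "0 < C'"
      "\<And>\<phi> M. \<phi> \<in> Z_space \<Longrightarrow> N' \<le> M \<Longrightarrow> (\<Sum>i\<in>I. q i \<phi>) \<le> C' * schwartz_norm M \<phi>"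
      using Z_boundedE[OF insert.IH] insert.prems by auto
    show ?case
      unfolding Z_bounded_def
    proof (intro exI ballI)
      fix \<phi> :: "real^'n \<Rightarrow> complex" assume "\<phi> \<in> Z_space"
      with C(2)[of \<phi> "max N N'"] C'(2)[of \<phi> "max N N'"]
      show "(\<Sum>i\<in>insert i I. q i \<phi>) \<le> (C + C') * schwartz_norm (max N N') \<phi>"
        using insert.hyps by (simp add: distrib_right)
    qed
  qed
next
  case False
  then show ?thesis
    unfolding Z_bounded_def by (intro exI[of _ 0]) simp
qed

definition Z_seminorm :: "((real^'n \<Rightarrow> complex) \<Rightarrow> real) \<Rightarrow> bool" where
  "Z_seminorm q \<longleftrightarrow>
    (\<forall>\<phi>\<in>Z_space. \<forall>\<eta>\<in>Z_space. q (\<lambda>x. \<phi> x + \<eta> x) \<le> q \<phi> + q \<eta>) \<and>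
    (\<forall>c. \<forall>\<phi>\<in>Z_space. q (\<lambda>x. c * \<phi> x) = norm c * q \<phi>)"

lemma Z_seminorm_triangle:
  "Z_seminorm q \<Longrightarrow> \<phi> \<in> Z_space \<Longrightarrow> \<eta> \<in> Z_space \<Longrightarrow> q (\<lambda>x. \<phi> x + \<eta> x) \<le> q \<phi> + q \<eta>"
  by (simp add: Z_seminorm_def)

lemma Z_seminorm_mult:
  "Z_seminorm q \<Longrightarrow> \<phi> \<in> Z_space \<Longrightarrow> q (\<lambda>x. c * \<phi> x) = norm c * q \<phi>"
  by (simp add: Z_seminorm_def)

lemma Z_seminorm_diff:
  assumes "Z_seminorm q" "\<phi> \<in> Z_space" "\<eta> \<in> Z_space"
  shows "q \<phi> \<le> q \<eta> + q (\<lambda>x. \<phi> x - \<eta> x)"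
  using Z_seminorm_triangle[OF assms(1,3) Z_space_diff[OF assms(2,3)]] by simp

text \<open>Since 2 \<xi> is the difference of \<eta> + \<xi> and \<eta> - \<xi>, q cannot be
  smaller than q \<xi> at both. A hump can thus be added to any point without cancellation, at the
  price of a sign.\<close>

lemma Z_seminorm_add_unit:
  assumes q: "Z_seminorm q" and "\<eta> \<in> Z_space" "\<xi> \<in> Z_space"
  obtains c where "norm c = 1" "q \<xi> \<le> q (\<lambda>x. \<eta> x + c * \<xi> x)"
proof -
  let ?p = "\<lambda>x. \<eta> x + 1 * \<xi> x" and ?m = "\<lambda>x. \<eta> x + (-1) * \<xi> x"
  have Z: "?p \<in> Z_space" "?m \<in> Z_space"
    using Z_space_lincomb[OF assms(2,3), of 1 1] Z_space_lincomb[OF assms(2,3), of 1 "-1"] by simp_all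
  have "2 * q \<xi> = q (\<lambda>x. 2 * \<xi> x)"
    by (simp add: Z_seminorm_mult[OF q assms(3)])
  also have "(\<lambda>x. 2 * \<xi> x) = (\<lambda>x. ?p x + (-1) * ?m x)"
    by auto
  also have "q \<dots> \<le> q ?p + q ?m"
    using Z_seminorm_triangle[OF q Z(1) Z_space_mult[OF Z(2), of "-1"]]
      Z_seminorm_mult[OF q Z(2), of "-1"] by simp
  finally have "q \<xi> \<le> q ?p \<or> q \<xi> \<le> q ?m"
    by linarith
  then show ?thesis
    using that[of 1] that[of "-1"] by auto
qed

text \<open>The gliding hump: if the conclusion fails, then signed small steps, at which the seminorms
  chosen so far change little while a new one becomes large, lead to a limit at which the
  sequence is unbounded.\<close>

lemma Z_uniform_boundedness:
  fixes q :: "nat \<Rightarrow> (real^'n \<Rightarrow> complex) \<Rightarrow> real"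
  assumes q: "\<And>n. Z_seminorm (q n)" and bounded: "\<And>n. Z_bounded (q n)"
    and incseq: "\<And>\<phi>. \<phi> \<in> Z_space \<Longrightarrow> incseq (\<lambda>n. q n \<phi>)"
    and bdd: "\<And>\<phi>. \<phi> \<in> Z_space \<Longrightarrow> bdd_above (range (\<lambda>n. q n \<phi>))"
  shows "\<exists>C N. \<forall>\<phi>\<in>Z_space. \<forall>n. q n \<phi> \<le> C * schwartz_norm N \<phi>"
proof (rule ccontr)
  assume neg: "\<nexists>C N. \<forall>\<phi>\<in>Z_space. \<forall>n. q n \<phi> \<le> C * schwartz_norm N \<phi>"
  have hump: "\<exists>\<xi>\<in>Z_space. \<exists>n. schwartz_norm N \<xi> \<le> \<delta> \<and> B \<le> q n \<xi>"
    if "0 < \<delta>" "0 < B" for N \<delta> B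
  proof -
    \<comment> \<open>With the constant B / \<delta>, rescaling \<phi> so that q n equals B forces
      its norm below \<delta>.\<close>
    obtain \<phi> n where \<phi>: "\<phi> \<in> Z_space" "B / \<delta> * schwartz_norm N \<phi> < q n \<phi>"
      using neg by (meson not_le)
    have norm: "0 \<le> schwartz_norm N \<phi>"
      using \<phi>(1) by (intro schwartz_norm_nonneg Z_space_schwartz)
    have pos: "0 < q n \<phi>"
      using \<phi>(2) that norm by (smt (verit) divide_pos_pos mult_nonneg_nonneg)
    define t where "t = B / q n \<phi>"
    have t: "0 < t"
      using pos that by (simp add: t_def)
    have "schwartz_norm N (\<lambda>x. of_real t * \<phi> x) \<le> t * schwartz_norm N \<phi>"
      using schwartz_norm_mult_le[OF Z_space_schwartz[OF \<phi>(1)], of N "of_real t"] t by simp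
    also have "\<dots> \<le> \<delta>"
      using \<phi>(2) pos that by (simp add: t_def field_simps)
    finally have "schwartz_norm N (\<lambda>x. of_real t * \<phi> x) \<le> \<delta>" .
    moreover have "q n (\<lambda>x. of_real t * \<phi> x) = B"
      using t pos by (simp add: Z_seminorm_mult[OF q \<phi>(1)]) (simp add: t_def)
    ultimately show ?thesis
      using Z_space_mult[OF \<phi>(1), of "of_real t"] by (metis order_refl)
  qed
  define P where "P = (\<lambda>(k :: nat) (s :: (real^'n \<Rightarrow> complex) \<times> nat). fst s \<in> Z_space)"
  \<comment> \<open>Smallness in \<open>schwartz_norm k\<close> gives convergence; smallness in
    \<open>q n\<close> preserves the largeness reached earlier. The extra 1 in
    \<open>real k + 1\<close> pays for all later steps, whose sizes add up to at most
    \<open>(1/2) ^ k\<close>.\<close>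
  define R where "R = (\<lambda>k (y, n) (y', n'). schwartz_norm k (\<lambda>x. y' x - y x) \<le> (1/2) ^ k \<and>
      q n (\<lambda>x. y' x - y x) \<le> (1/2) ^ k \<and> real k + 1 \<le> q n' y' \<and> n \<le> n')"
  have "\<exists>s. \<forall>k. P k (s k) \<and> R k (s k) (s (Suc k))"
  proof (rule dependent_nat_choice)
    \<comment> \<open>Some element of \<open>Z_space\<close> comes from \<open>hump\<close>, and 0
      times it is the zero function.\<close>
    have "(\<lambda>x :: real^'n. 0) \<in> Z_space"
      using hump[of 1 1] Z_space_mult[of _ 0] by auto
    then show "\<exists>s. P 0 s"
      by (auto simp: P_def)
  next
    fix s k assume "P k s"
    then obtain y n where s: "s = (y, n)" and y: "y \<in> Z_space"
      by (cases s) (simp add: P_def)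
    obtain C M where C: "0 < C" "\<And>\<phi> N. \<phi> \<in> Z_space \<Longrightarrow> M \<le> N \<Longrightarrow> q n \<phi> \<le> C * schwartz_norm N \<phi>"
      using Z_boundedE[OF bounded[of n]] by metis
    \<comment> \<open>Dividing by C + 1, which exceeds both 1 and C, makes \<xi> small in
      \<open>schwartz_norm k\<close> and in \<open>q n\<close> at the same time;
      \<open>max k M\<close> serves both bounds.\<close>
    obtain \<xi> m where \<xi>: "\<xi> \<in> Z_space" "schwartz_norm (max k M) \<xi> \<le> (1/2) ^ k / (C + 1)"
        "real k + 1 \<le> q m \<xi>"
      using hump[of "(1/2) ^ k / (C + 1)" "real k + 1" "max k M"] C(1) by auto
    obtain c where c: "norm c = 1" "q m \<xi> \<le> q m (\<lambda>x. y x + c * \<xi> x)"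
      using Z_seminorm_add_unit[OF q y \<xi>(1)] by metis
    let ?y = "\<lambda>x. y x + c * \<xi> x"
    have y': "?y \<in> Z_space"
      by (intro Z_space_add Z_space_mult y \<xi>(1))
    have norm_nonneg: "0 \<le> schwartz_norm (max k M) \<xi>"
      using \<xi>(1) by (intro schwartz_norm_nonneg Z_space_schwartz)
    then have small: "(C + 1) * schwartz_norm (max k M) \<xi> \<le> (1/2) ^ k"
      using \<xi>(2) C(1) by (simp add: pos_le_divide_eq mult.commute)
    have "schwartz_norm k (\<lambda>x. ?y x - y x) \<le> schwartz_norm k \<xi>"
      using schwartz_norm_mult_le[OF Z_space_schwartz[OF \<xi>(1)], of k c] c(1) by simp
    also have "\<dots> \<le> schwartz_norm (max k M) \<xi>"
      by (intro schwartz_norm_mono Z_space_schwartz \<xi>(1)) simp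
    also have "\<dots> \<le> (1/2) ^ k"
      using small norm_nonneg C(1) by (smt (verit) mult_le_cancel_right1)
    finally have 1: "schwartz_norm k (\<lambda>x. ?y x - y x) \<le> (1/2) ^ k" .
    have "q n (\<lambda>x. ?y x - y x) = q n \<xi>"
      using Z_seminorm_mult[OF q \<xi>(1), of n c] c(1) by simp
    also have "\<dots> \<le> (C + 1) * schwartz_norm (max k M) \<xi>"
      using C(2)[OF \<xi>(1), of "max k M"] norm_nonneg by (simp add: distrib_right)
    finally have 2: "q n (\<lambda>x. ?y x - y x) \<le> (1/2) ^ k"
      using small by linarith
    \<comment> \<open>Passing to \<open>max n m\<close> keeps the indices increasing, and
      monotonicity of q keeps the new value large.\<close>
    have "q m ?y \<le> q (max n m) ?y"
      using incseq[OF y'] by (simp add: incseq_def)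
    with c(2) \<xi>(3) have 3: "real k + 1 \<le> q (max n m) ?y"
      by linarith
    have "P (Suc k) (?y, max n m)"
      using y' by (simp add: P_def)
    moreover have "R k s (?y, max n m)"
      using 1 2 3 by (simp add: R_def s)
    ultimately show "\<exists>s'. P (Suc k) s' \<and> R k s s'"
      by blast
  qed
  then obtain s where s: "\<And>k. P k (s k)" "\<And>k. R k (s k) (s (Suc k))"
    by blast
  define y n where "y k = fst (s k)" and "n k = snd (s k)" for k
  have y: "y k \<in> Z_space" for k
    using s(1)[of k] by (simp add: P_def y_def)
  have step: "schwartz_norm k (\<lambda>x. y (Suc k) x - y k x) \<le> (1/2) ^ k"
    "q (n k) (\<lambda>x. y (Suc k) x - y k x) \<le> (1/2) ^ k"
    "real k + 1 \<le> q (n (Suc k)) (y (Suc k))" "n k \<le> n (Suc k)" for k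
    using s(2)[of k] by (simp_all add: R_def y_def n_def case_prod_unfold)
  have n: "n j \<le> n k" if "j \<le> k" for j k
    using that step(4) lift_Suc_mono_le[of n] by blast
  obtain f where f: "f \<in> Z_space" "\<And>N. (\<lambda>k. schwartz_norm N (\<lambda>x. f x - y k x)) \<longlonglongrightarrow> 0"
    using Z_space_complete[OF y step(1)] by blast
  have large: "real j \<le> q (n (Suc j)) f" for j
  proof -
    let ?q = "q (n (Suc j))"
    \<comment> \<open>The added term is the total of the steps still to come. Step \<open>?k\<close>
      is controlled in \<open>q (n ?k)\<close>, which dominates \<open>?q\<close>.\<close>
    have tail: "real j + 2 * (1/2) ^ (Suc j + i) \<le> ?q (y (Suc j + i))" for i
    proof (induction i)
      case 0
      have "(1/2 :: real) ^ j \<le> 1"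
        by (simp add: power_le_one)
      with step(3)[of j] show ?case
        by simp
    next
      case (Suc i)
      let ?k = "Suc j + i"
      have "?q (y ?k) \<le> ?q (y (Suc ?k)) + ?q (\<lambda>x. y ?k x - y (Suc ?k) x)"
        by (intro Z_seminorm_diff q y)
      also have "?q (\<lambda>x. y ?k x - y (Suc ?k) x) = ?q (\<lambda>x. y (Suc ?k) x - y ?k x)"
        using Z_seminorm_mult[OF q Z_space_diff[OF y y], of "n (Suc j)" "-1" "Suc ?k" ?k] by simp
      also have "\<dots> \<le> q (n ?k) (\<lambda>x. y (Suc ?k) x - y ?k x)"
        using incseq[OF Z_space_diff[OF y y]] n[of "Suc j" ?k] by (simp add: incseq_def)
      also have "\<dots> \<le> (1/2) ^ ?k"
        by (rule step(2))
      finally show ?case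
        using Suc by simp
    qed
    \<comment> \<open>Continuity of \<open>?q\<close> carries the lower bound from the sequence over
      to its limit f.\<close>
    obtain C M where C: "0 < C" "\<And>\<phi> N. \<phi> \<in> Z_space \<Longrightarrow> M \<le> N \<Longrightarrow> ?q \<phi> \<le> C * schwartz_norm N \<phi>"
      using Z_boundedE[OF bounded[of "n (Suc j)"]] by metis
    have "real j \<le> ?q f + C * schwartz_norm M (\<lambda>x. f x - y (Suc j + i) x)" for i
    proof -
      let ?k = "Suc j + i"
      have "real j \<le> ?q (y ?k)"
        using tail[of i] by (smt (verit) zero_le_power divide_nonneg_nonneg)
      also have "\<dots> \<le> ?q f + ?q (\<lambda>x. y ?k x - f x)"
        by (intro Z_seminorm_diff q y f)
      also have "?q (\<lambda>x. y ?k x - f x) = ?q (\<lambda>x. f x - y ?k x)"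
        using Z_seminorm_mult[OF q Z_space_diff[OF f(1) y], of "n (Suc j)" "-1" ?k] by simp
      also have "\<dots> \<le> C * schwartz_norm M (\<lambda>x. f x - y ?k x)"
        by (intro C(2) Z_space_diff f y) simp
      finally show ?thesis
        by simp
    qed
    moreover have "(\<lambda>i. ?q f + C * schwartz_norm M (\<lambda>x. f x - y (i + Suc j) x)) \<longlonglongrightarrow> ?q f + C * 0"
      by (intro tendsto_intros LIMSEQ_ignore_initial_segment[OF f(2)])
    ultimately show ?thesis
      by (intro LIMSEQ_le_const[where X = "\<lambda>i. ?q f + C * schwartz_norm M (\<lambda>x. f x - y (i + Suc j) x)"])
        (auto simp: add.commute)
  qed
  obtain B where B: "\<And>m. q m f \<le> B"
    using bdd[OF f(1)] by (auto simp: bdd_above_def)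
  obtain j where "B < real j"
    using reals_Archimedean2 by blast
  with large[of j] B[of "n (Suc j)"] show False
    by linarith
qed

section \<open>The dual space\<close>

definition Z_antilinear :: "((real^'n \<Rightarrow> complex) \<Rightarrow> complex) \<Rightarrow> bool" where
  "Z_antilinear u \<longleftrightarrow>
    (\<forall>\<phi>\<in>Z_space. \<forall>\<eta>\<in>Z_space. u (\<lambda>x. \<phi> x + \<eta> x) = u \<phi> + u \<eta>) \<and>
    (\<forall>c. \<forall>\<phi>\<in>Z_space. u (\<lambda>x. c * \<phi> x) = cnj c * u \<phi>)"

lemma Z_antilinear_diff:
  assumes u: "Z_antilinear u" and "\<phi> \<in> Z_space" "\<eta> \<in> Z_space"
  shows "u (\<lambda>x. \<phi> x - \<eta> x) = u \<phi> - u \<eta>"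
proof -
  have add: "u (\<lambda>x. \<xi> x + \<eta> x) = u \<xi> + u \<eta>" if "\<xi> \<in> Z_space" for \<xi>
    using u that assms(3) by (simp add: Z_antilinear_def)
  have "u (\<lambda>x. (\<phi> x - \<eta> x) + \<eta> x) = u (\<lambda>x. \<phi> x - \<eta> x) + u \<eta>"
    by (rule add[OF Z_space_diff[OF assms(2,3)]])
  then show ?thesis
    by simp
qed

section \<open>From the generated topology to seminorm estimates\<close>

lemma schwartz_topology_ball:
  fixes f :: "real^'n \<Rightarrow> complex"
  assumes f: "f \<in> schwartz" and "0 < r"
  shows "openin schwartz_topology {g \<in> schwartz. schwartz_seminorm \<alpha> is (\<lambda>x. g x - f x) < r}"
    and "schwartz_seminorm \<alpha> is (\<lambda>x. f x - f x) < r"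
proof -
  show "openin schwartz_topology {g \<in> schwartz. schwartz_seminorm \<alpha> is (\<lambda>x. g x - f x) < r}"
    unfolding schwartz_topology_def by (rule topology_generated_by_Basis) (use assms in blast)
  show "schwartz_seminorm \<alpha> is (\<lambda>x. f x - f x) < r"
    using schwartz_seminorm_mult_le[OF f, of \<alpha> "is" 0] \<open>0 < r\<close> by simp
qed

lemma schwartz_subset_topspace: "schwartz \<subseteq> topspace schwartz_topology"
proof
  fix f :: "real^'n \<Rightarrow> complex" assume f: "f \<in> schwartz"
  let ?B = "{g \<in> schwartz. schwartz_seminorm (\<lambda>_. 0) [] (\<lambda>x. g x - f x) < 1}"
  have "f \<in> ?B"
    using f schwartz_topology_ball(2)[OF f zero_less_one] by blast
  then show "f \<in> topspace schwartz_topology"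
    using openin_subset[OF schwartz_topology_ball(1)[OF f zero_less_one]] by blast
qed

text \<open>The generating sets are balls of single seminorms. Since \<open>schwartz_norm N\<close>
  has N + 1 summands, intersecting N + 1 such balls of radius r / (N + 1) is enough.\<close>

lemma schwartz_norm_ball_neighbourhood:
  fixes f :: "real^'n \<Rightarrow> complex"
  assumes f: "f \<in> schwartz" and "0 < r"
  shows "\<exists>U. openin schwartz_topology U \<and> f \<in> U \<and>
    (\<forall>g\<in>U. schwartz_norm N (\<lambda>x. g x - f x) \<le> r)"
proof -
  define \<rho> where "\<rho> = r / real (Suc N)"
  have \<rho>: "0 < \<rho>"
    using \<open>0 < r\<close> by (simp add: \<rho>_def)
  define B where "B k = {g \<in> schwartz. (case from_nat k of (\<alpha>, is) \<Rightarrow>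
    schwartz_seminorm \<alpha> is (\<lambda>x. g x - f x)) < \<rho>}" for k :: nat
  have open_B: "openin schwartz_topology (B k)" for k
  proof -
    obtain \<alpha> :: "'n \<Rightarrow> nat" and "is" :: "'n list" where k: "from_nat k = (\<alpha>, is)"
      by fastforce
    show ?thesis
      unfolding B_def k prod.case by (rule schwartz_topology_ball[OF f \<rho>])
  qed
  have "f \<in> B k" for k
    unfolding B_def using f schwartz_topology_ball(2)[OF f \<rho>] by (auto split: prod.split)
  moreover have "schwartz_norm N (\<lambda>x. g x - f x) \<le> r" if g: "g \<in> (\<Inter>k\<in>{..N}. B k)" for g
  proof -
    have "schwartz_norm N (\<lambda>x. g x - f x) \<le> (\<Sum>k\<le>N. \<rho>)"
      unfolding schwartz_norm_def
    proof (rule sum_mono)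
      fix k assume "k \<in> {..N}"
      with g have "g \<in> B k"
        by blast
      then show "(case from_nat k of (\<alpha>, is) \<Rightarrow> schwartz_seminorm \<alpha> is (\<lambda>x. g x - f x)) \<le> \<rho>"
        by (simp add: B_def)
    qed
    also have "\<dots> = r"
      by (simp add: \<rho>_def)
    finally show ?thesis .
  qed
  moreover have "openin schwartz_topology (\<Inter>k\<in>{..N}. B k)"
    by (intro openin_INT2 open_B) auto
  ultimately show ?thesis
    by blast
qed

lemma Z_dualI:
  fixes u :: "(real^'n \<Rightarrow> complex) \<Rightarrow> complex"
  assumes u: "u \<in> extensional Z_space" "Z_antilinear u" and bounded: "Z_bounded (\<lambda>\<phi>. norm (u \<phi>))"
  shows "u \<in> Z_dual"
proof -
  let ?X = "subtopology schwartz_topology (Z_space :: (real^'n \<Rightarrow> complex) set)"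
  have top: "topspace ?X = Z_space"
    using Z_space_schwartz schwartz_subset_topspace by (auto simp: topspace_subtopology)
  obtain C N where C: "0 < C"
      "\<And>\<phi> M. \<phi> \<in> Z_space \<Longrightarrow> N \<le> M \<Longrightarrow> norm (u \<phi>) \<le> C * schwartz_norm M \<phi>"
    using Z_boundedE[OF bounded] by metis
  have "openin ?X {\<phi> \<in> topspace ?X. u \<phi> \<in> U}" if U: "open U" for U
  proof (subst openin_subopen, intro ballI)
    fix f assume "f \<in> {\<phi> \<in> topspace ?X. u \<phi> \<in> U}"
    then have f: "f \<in> Z_space" "u f \<in> U"
      by (auto simp: top)
    then obtain e where e: "0 < e" "\<And>z. dist z (u f) < e \<Longrightarrow> z \<in> U"
      using U by (auto simp: open_dist)
    \<comment> \<open>The 2 turns the non-strict bound on W into the strict inequality needed for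
      e.\<close>
    obtain W where W: "openin schwartz_topology W" "f \<in> W"
        "\<And>g. g \<in> W \<Longrightarrow> schwartz_norm N (\<lambda>x. g x - f x) \<le> e / (2 * C)"
      using schwartz_norm_ball_neighbourhood[OF Z_space_schwartz[OF f(1)], of "e / (2 * C)" N] e(1) C(1)
      by auto
    have "u g \<in> U" if g: "g \<in> W \<inter> Z_space" for g
    proof (rule e(2))
      have "norm (u g - u f) \<le> C * schwartz_norm N (\<lambda>x. g x - f x)"
        using C(2)[OF Z_space_diff[of g f], of N] g f(1) Z_antilinear_diff[OF u(2), of g f] by auto
      also have "\<dots> \<le> C * (e / (2 * C))"
        using g C(1) by (intro mult_left_mono W(3)) auto
      also have "\<dots> < e"
        using e(1) C(1) by simp
      finally show "dist (u g) (u f) < e"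
        by (simp add: dist_norm)
    qed
    moreover have "openin ?X (W \<inter> Z_space)"
      using W(1) by (auto simp: openin_subtopology)
    ultimately show "\<exists>T. openin ?X T \<and> f \<in> T \<and> T \<subseteq> {\<phi> \<in> topspace ?X. u \<phi> \<in> U}"
      using W(2) f(1) unfolding top by (intro exI[of _ "W \<inter> Z_space"]) auto
  qed
  then have "continuous_map ?X euclidean u"
    by (simp add: continuous_map_def)
  with u show ?thesis
    by (simp add: Z_dual_def Z_antilinear_def)
qed

text \<open>The integral estimates concern \<phi>, not its conjugate, so the conjugation is moved to
  f and the whole integral is conjugated.\<close>

lemma
  fixes f :: "real^'n \<Rightarrow> complex"
  assumes "f \<in> borel_measurable lborel" "\<And>x. norm (f x) \<le> B"
  shows pairing_antilinear: "Z_antilinear (pairing f)"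
    and pairing_bounded: "Z_bounded (\<lambda>\<phi>. norm (pairing f \<phi>))"
proof -
  have cnj_f: "(\<lambda>x. cnj (f x)) \<in> borel_measurable lborel" "\<And>x. norm (cnj (f x)) \<le> B"
    using assms(2) measurable_compose[OF assms(1) borel_measurable_continuous_onI[of cnj]]
    by (simp_all add: continuous_on_cnj)
  have int: "integrable lborel (\<lambda>x. f x * cnj (\<phi> x))" if "\<phi> \<in> Z_space" for \<phi>
  proof -
    have "integrable lborel (\<lambda>x. cnj (f x) * \<phi> x)"
      using integrable_bounded_mult_schwartz[OF Z_space_schwartz[OF that] cnj_f, of "\<lambda>_. 0"]
      by (simp add: monomial_def)
    then show ?thesis
      using integrable_cnj[of lborel "\<lambda>x. cnj (f x) * \<phi> x"] by simp
  qed
  show "Z_antilinear (pairing f)"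
    unfolding Z_antilinear_def pairing_def
    by (simp add: distrib_left Bochner_Integration.integral_add int mult.left_commute)
  obtain C N where C: "0 \<le> C"
      "\<And>g :: real^'n \<Rightarrow> complex. g \<in> schwartz \<Longrightarrow> decay_norm (\<lambda>_. 0) g \<le> C * schwartz_norm N g"
    using decay_norm_le_schwartz_norm by blast
  define I where "I = integral\<^sup>L lborel (cauchy_weight :: real^'n \<Rightarrow> real)"
  have I: "0 \<le> I"
    unfolding I_def by (intro Bochner_Integration.integral_nonneg cauchy_weight_nonneg)
  have B: "0 \<le> B"
    using assms(2) norm_ge_zero order_trans by blast
  have "norm (pairing f \<phi>) \<le> B * I * C * schwartz_norm N \<phi>" if "\<phi> \<in> Z_space" for \<phi>
  proof -
    have "pairing f \<phi> = cnj (\<integral>x. cnj (f x) * \<phi> x \<partial>lborel)"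
      unfolding pairing_def Bochner_Integration.integral_cnj[symmetric] by simp
    then have "norm (pairing f \<phi>) \<le> B * I * decay_norm (\<lambda>_. 0) \<phi>"
      using norm_integral_bounded_mult_schwartz_le[OF Z_space_schwartz[OF that] cnj_f, of "\<lambda>_. 0"]
      by (simp add: monomial_def I_def)
    also have "\<dots> \<le> B * I * (C * schwartz_norm N \<phi>)"
      using that B I by (intro mult_left_mono C(2) Z_space_schwartz) auto
    finally show ?thesis
      by (simp add: mult.assoc)
  qed
  then show "Z_bounded (\<lambda>\<phi>. norm (pairing f \<phi>))"
    unfolding Z_bounded_def by blast
qed

lemma scaled_translate_bounded:
  fixes \<psi> :: "real^'n \<Rightarrow> complex"
  assumes "\<psi> \<in> schwartz"
  shows "scaled_translate \<psi> \<nu> k \<in> borel_measurable lborel"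
    and "\<exists>B. \<forall>x. norm (scaled_translate \<psi> \<nu> k x) \<le> B"
proof -
  have "continuous_on UNIV (\<lambda>x. \<psi> (2 powi \<nu> *\<^sub>R x - (\<chi> i. of_int (k $ i))))"
    by (rule continuous_on_compose2[OF smooth_continuous[OF schwartz_smooth[OF assms]]])
      (auto intro!: continuous_intros)
  then show "scaled_translate \<psi> \<nu> k \<in> borel_measurable lborel"
    unfolding scaled_translate_def[abs_def]
    by (simp add: borel_measurable_continuous_onI continuous_on_mult_left)
  have "norm (\<psi> x) \<le> schwartz_seminorm (\<lambda>_. 0) [] \<psi>" for x
    using schwartz_seminorm_upper[OF assms, of "\<lambda>_. 0" x "[]"] by (simp add: monomial_def)
  then have "norm (scaled_translate \<psi> \<nu> k x) \<le>
      norm (complex_of_real (2 powr (real CARD('n) * real_of_int \<nu> / 2))) *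
        schwartz_seminorm (\<lambda>_. 0) [] \<psi>" for x
    unfolding scaled_translate_def norm_mult by (intro mult_left_mono) auto
  then show "\<exists>B. \<forall>x. norm (scaled_translate \<psi> \<nu> k x) \<le> B"
    by blast
qed

lemma wavelet_pairing:
  fixes \<psi> :: "real^'n \<Rightarrow> complex"
  assumes "\<psi> \<in> schwartz" "R \<in> dyadic_cubes"
  shows "Z_antilinear (pairing (wavelet \<psi> R))" and "Z_bounded (\<lambda>\<phi>. norm (pairing (wavelet \<psi> R) \<phi>))"
proof -
  obtain \<nu> k where R: "R = dyadic_cube \<nu> k"
    using assms(2) by (auto simp: dyadic_cubes_def)
  obtain B where "\<And>x. norm (scaled_translate \<psi> \<nu> k x) \<le> B"
    using scaled_translate_bounded(2)[OF assms(1)] by blast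
  then show "Z_antilinear (pairing (wavelet \<psi> R))" "Z_bounded (\<lambda>\<phi>. norm (pairing (wavelet \<psi> R) \<phi>))"
    unfolding R wavelet_dyadic_cube
    by (rule pairing_antilinear[OF scaled_translate_bounded(1)[OF assms(1)]]
        pairing_bounded[OF scaled_translate_bounded(1)[OF assms(1)]])+
qed

section \<open>Weak-star convergence of absolutely convergent series\<close>

lemma Z_bounded_mono:
  assumes "Z_bounded q" "\<And>\<phi>. \<phi> \<in> Z_space \<Longrightarrow> p \<phi> \<le> q \<phi>"
  shows "Z_bounded p"
  using assms unfolding Z_bounded_def by (meson order_trans)

lemma Z_bounded_mult:
  assumes "Z_bounded q" "0 \<le> c"
  shows "Z_bounded (\<lambda>\<phi>. c * q \<phi>)"
proof -
  obtain C N where "\<And>\<phi>. \<phi> \<in> Z_space \<Longrightarrow> q \<phi> \<le> C * schwartz_norm N \<phi>"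
    using assms(1) unfolding Z_bounded_def by blast
  then have "\<forall>\<phi>\<in>Z_space. c * q \<phi> \<le> c * C * schwartz_norm N \<phi>"
    using assms(2) by (simp add: mult.assoc mult_left_mono)
  then show ?thesis
    unfolding Z_bounded_def by blast
qed

lemma Z_antilinear_sum:
  assumes "\<And>i. i \<in> I \<Longrightarrow> Z_antilinear (u i)"
  shows "Z_antilinear (\<lambda>\<phi>. \<Sum>i\<in>I. u i \<phi>)"
  using assms by (simp add: Z_antilinear_def sum.distrib sum_distrib_left)

lemma Z_antilinear_restrict:
  assumes "Z_antilinear u"
  shows "Z_antilinear (restrict u Z_space)"
  using assms by (simp add: Z_antilinear_def Z_space_add Z_space_mult)

text \<open>Convergence in the subspace topology means pointwise convergence together with
  membership in \<open>Z_dual\<close>. Membership of the limit comes from uniform boundedness of q,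
  the partial sums of the norms: they are increasing and bounded at each \<phi>, and their common
  bound also bounds the full sum.\<close>

lemma limitin_Z_dual_series:
  fixes v :: "nat \<Rightarrow> (real^'n \<Rightarrow> complex) \<Rightarrow> complex"
  assumes antilinear: "\<And>j. Z_antilinear (v j)" and bounded: "\<And>j. Z_bounded (\<lambda>\<phi>. norm (v j \<phi>))"
    and summable: "\<And>\<phi>. \<phi> \<in> Z_space \<Longrightarrow> summable (\<lambda>j. norm (v j \<phi>))"
  shows "limitin Z_dual_topology (\<lambda>N. \<lambda>\<phi>\<in>Z_space. \<Sum>j<N. v j \<phi>)
    (\<lambda>\<phi>\<in>Z_space. \<Sum>j. v j \<phi>) sequentially"
proof -
  let ?s = "\<lambda>N. \<lambda>\<phi>\<in>Z_space. \<Sum>j<N. v j \<phi>" and ?t = "\<lambda>\<phi>\<in>Z_space. \<Sum>j. v j \<phi>"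
  define q where "q n \<phi> = (\<Sum>j<n. norm (v j \<phi>))" for n \<phi>
  have q_bounded: "Z_bounded (q n)" for n
    unfolding q_def[abs_def] by (intro Z_bounded_sum bounded)
  have s: "?s N \<in> Z_dual" for N
  proof (rule Z_dualI)
    show "Z_bounded (\<lambda>\<phi>. norm (?s N \<phi>))"
      by (rule Z_bounded_mono[OF q_bounded[of N]]) (simp add: q_def norm_sum)
  qed (intro restrict_extensional Z_antilinear_restrict Z_antilinear_sum antilinear)+
  have q_le: "q n \<phi> \<le> (\<Sum>j. norm (v j \<phi>))" if "\<phi> \<in> Z_space" for n \<phi>
    unfolding q_def by (intro sum_le_suminf summable that) auto
  have "\<exists>C N. \<forall>\<phi>\<in>Z_space. \<forall>n. q n \<phi> \<le> C * schwartz_norm N \<phi>"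
  proof (rule Z_uniform_boundedness)
    show "Z_seminorm (q n)" for n
      using antilinear unfolding Z_seminorm_def q_def Z_antilinear_def
      by (auto simp: norm_mult sum_distrib_left simp flip: sum.distrib intro!: sum_mono norm_triangle_ineq)
    show "incseq (\<lambda>n. q n \<phi>)" for \<phi>
      unfolding q_def by (intro incseq_SucI) simp
    show "bdd_above (range (\<lambda>n. q n \<phi>))" if "\<phi> \<in> Z_space" for \<phi>
      using q_le[OF that] by (auto simp: bdd_above_def)
  qed (rule q_bounded)
  then obtain C N where C: "\<And>\<phi> n. \<phi> \<in> Z_space \<Longrightarrow> q n \<phi> \<le> C * schwartz_norm N \<phi>"
    by blast
  have t: "?t \<in> Z_dual"
  proof (rule Z_dualI)
    have sums: "summable (\<lambda>j. v j \<phi>)" if "\<phi> \<in> Z_space" for \<phi>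
      using summable[OF that] by (rule summable_norm_cancel)
    have "Z_antilinear (\<lambda>\<phi>. \<Sum>j. v j \<phi>)"
      using antilinear unfolding Z_antilinear_def
      by (simp add: suminf_add[OF sums sums] suminf_mult[OF sums])
    then show "Z_antilinear ?t"
      by (rule Z_antilinear_restrict)
    have "norm (?t \<phi>) \<le> C * schwartz_norm N \<phi>" if "\<phi> \<in> Z_space" for \<phi>
    proof -
      have "norm (\<Sum>j. v j \<phi>) \<le> (\<Sum>j. norm (v j \<phi>))"
        by (rule summable_norm[OF summable[OF that]])
      also have "\<dots> \<le> C * schwartz_norm N \<phi>"
        by (rule suminf_le_const[OF summable[OF that]]) (use C[OF that] in \<open>simp add: q_def\<close>)
      finally show ?thesis
        using that by simp
    qed
    then show "Z_bounded (\<lambda>\<phi>. norm (?t \<phi>))"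
      unfolding Z_bounded_def by blast
  qed simp
  have "(\<lambda>N. ?s N \<phi>) \<longlonglongrightarrow> ?t \<phi>" if "\<phi> \<in> Z_space" for \<phi>
    using summable_LIMSEQ[OF summable_norm_cancel[OF summable[OF that]]] that by simp
  then show ?thesis
    unfolding Z_dual_topology_def
    by (simp add: limitin_subtopology limitin_componentwise s t)
qed

theorem corollary3p9:
  fixes \<psi> :: "real^'n \<Rightarrow> complex"
    and a :: "(real^'n) set \<Rightarrow> complex"
    and Q :: "nat \<Rightarrow> (real^'n) set"
    and K\<^sub>0 K\<^sub>1 L\<^sub>1 L\<^sub>0 :: real
  assumes "0 < K\<^sub>0" "K\<^sub>0 < K\<^sub>1" "K\<^sub>1 < 1" "1 < L\<^sub>1" "L\<^sub>1 < L\<^sub>0"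
    and "2 * K\<^sub>1 < L\<^sub>1" "L\<^sub>0 < pi"
    and "admissible K\<^sub>0 K\<^sub>1 L\<^sub>1 L\<^sub>0 \<psi>"
    and "a \<in> D_synthesis \<psi>"
    and "bij_betw Q UNIV dyadic_cubes"
  shows "limitin Z_dual_topology
           (\<lambda>N. \<lambda>\<phi>\<in>Z_space. \<Sum>j<N. a (Q j) * Z_class (wavelet \<psi> (Q j)) \<phi>)
           (synthesis \<psi> a) sequentially"
proof -
  let ?v = "\<lambda>j \<phi>. a (Q j) * pairing (wavelet \<psi> (Q j)) \<phi>"
  have \<psi>: "\<psi> \<in> schwartz"
    using assms(8) by (simp add: admissible_def)
  have Q: "Q j \<in> dyadic_cubes" for j
    using assms(10) by (auto simp: bij_betw_def)
  have summable: "summable (\<lambda>j. norm (?v j \<phi>))" if "\<phi> \<in> Z_space" for \<phi>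
  proof -
    \<comment> \<open>Unordered summability over the cubes is transported along Q; for nonnegative
      terms on the naturals it is ordinary summability.\<close>
    have "(\<lambda>R. norm (a R * pairing (wavelet \<psi> R) \<phi>)) summable_on dyadic_cubes"
      using assms(9) that by (simp add: D_synthesis_def norm_mult)
    then have "(\<lambda>j. norm (?v j \<phi>)) summable_on UNIV"
      using summable_on_reindex_bij_betw[OF assms(10),
          of "\<lambda>R. norm (a R * pairing (wavelet \<psi> R) \<phi>)"] by blast
    then show ?thesis
      by (simp add: summable_on_UNIV_nonneg_real_iff)
  qed
  have "limitin Z_dual_topology (\<lambda>N. \<lambda>\<phi>\<in>Z_space. \<Sum>j<N. ?v j \<phi>)
      (\<lambda>\<phi>\<in>Z_space. \<Sum>j. ?v j \<phi>) sequentially"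
  proof (rule limitin_Z_dual_series[OF _ _ summable])
    show "Z_antilinear (?v j)" for j
      using wavelet_pairing(1)[OF \<psi> Q[of j]] by (simp add: Z_antilinear_def distrib_left mult.left_commute)
    show "Z_bounded (\<lambda>\<phi>. norm (?v j \<phi>))" for j
      using Z_bounded_mult[OF wavelet_pairing(2)[OF \<psi> Q[of j]]] by (simp add: norm_mult)
  qed
  moreover have "(\<lambda>\<phi>\<in>Z_space. \<Sum>j<N. a (Q j) * Z_class (wavelet \<psi> (Q j)) \<phi>) =
      (\<lambda>\<phi>\<in>Z_space. \<Sum>j<N. ?v j \<phi>)" for N
    by (auto simp: Z_class_def restrict_def)
  \<comment> \<open>The bijection Q moves the counting measure to the naturals, where absolute
    summability identifies the integral with the sum of the series; hence the order does not
    matter.\<close>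
  moreover have "synthesis \<psi> a = (\<lambda>\<phi>\<in>Z_space. \<Sum>j. ?v j \<phi>)"
    unfolding synthesis_def
  proof (rule restrict_ext)
    fix \<phi> :: "real^'n \<Rightarrow> complex" assume "\<phi> \<in> Z_space"
    then have "integrable (count_space UNIV) (\<lambda>j. ?v j \<phi>)"
      unfolding integrable_count_space_nat_iff by (rule summable)
    then have "(\<lambda>j. ?v j \<phi>) sums (\<integral>j. ?v j \<phi> \<partial>count_space UNIV)"
      by (rule sums_integral_count_space_nat)
    then show "(\<integral>R. a R * pairing (wavelet \<psi> R) \<phi> \<partial>count_space dyadic_cubes) = (\<Sum>j. ?v j \<phi>)"
      using integral_bij_count_space[OF assms(10), of "\<lambda>R. a R * pairing (wavelet \<psi> R) \<phi>"]
      by (simp add: sums_unique)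
  qed
  ultimately show ?thesis
    by simp
qed

end
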